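(* Let $(R,\mathfrak{M})$ be a quasilocal commutative ring with identity. Then $GF(R)$ is connected if and only if $\mathfrak{M}$ is finitely generated, and likewise $GP(R)$ is connected if and only if $\mathfrak{M}$ is finitely generated. Additionally: (1) If $GF(R)$ is connected, then $\operatorname{diam}(GF(R))\leq 2$, and $GF(R)$ is complete if and only if $R$ is a Noetherian chained ring of dimension no more than $1$. (2) If $GP(R)$ is connected, then $\operatorname{diam}(GP(R))\leq 2n$, where $n$ is the minimal number of generators required for $\mathfrak{M}$, and $GP(R)$ is complete if and only if $R$ is a principal ideal ring (PIR).
   Context: Quasilocal means having a unique maximal ideal (not necessarily Noetherian), here $\mathfrak{M}$. A ring is chained if its ideals are totally ordered by inclusion. $GF(R)$ and $GP(R)$ are the simple undirected graphs whose vertices are the proper ideals of $R$; two distinct proper ideals have an edge between them in $GF(R)$ (resp. $GP(R)$) if and only if, for one of the two orderings $(I,J)$ of the pair, $I\subset J$ and $J/I$ is a finitely generated (resp. principal) ideal of $R/I$. The diameter $\operatorname{diam}$ of a graph is the supremum of the distances between pairs of vertices. *)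

theory Defs
  imports
    "HOL-Algebra.Algebra"
    "HOL-Library.Extended_Nat"
    "Graph_Theory.Graph_Theory"
begin

locale quasilocal_ring = maximalideal M R + cring R for M and R (structure) +
  assumes maximal_unique: "maximalideal J R \<Longrightarrow> J = M"

locale chained_ring = cring +
  assumes ideals_total: "\<lbrakk>ideal I R; ideal J R\<rbrakk> \<Longrightarrow> I \<subseteq> J \<or> J \<subseteq> I"

locale principal_ideal_ring = cring +
  assumes all_principal: "ideal I R \<Longrightarrow> principalideal I R"

definition finitely_generated_ideal :: "'a set \<Rightarrow> ('a, 'b) ring_scheme \<Rightarrow> bool" where
  "finitely_generated_ideal I R \<longleftrightarrow>
     ideal I R \<and> (\<exists>A \<subseteq> carrier R. finite A \<and> I = Idl\<^bsub>R\<^esub> A)"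

text \<open>Meaningful only for finitely generated ideals; the zero ideal needs 0 generators.\<close>

definition min_generators :: "('a, 'b) ring_scheme \<Rightarrow> 'a set \<Rightarrow> nat" where
  "min_generators R I =
     (LEAST n. \<exists>A \<subseteq> carrier R. finite A \<and> card A = n \<and> I = Idl\<^bsub>R\<^esub> A)"

text \<open>
  Supremum of the lengths of strict chains of prime ideals, a chain \<open>P 0 \<subset> \<dots> \<subset> P n\<close> having
  length \<open>n\<close>. As a supremum in \<open>enat\<close> it is 0 for the zero ring.
\<close>

definition krull_dim :: "('a, 'b) ring_scheme \<Rightarrow> enat" where
  "krull_dim R =
     (SUP n \<in> {n. \<exists>P :: nat \<Rightarrow> 'a set.
                    (\<forall>i\<le>n. primeideal (P i) R) \<and> (\<forall>i<n. P i \<subset> P (Suc i))}. enat n)"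

definition quotient_ideal :: "('a, 'b) ring_scheme \<Rightarrow> 'a set \<Rightarrow> 'a set \<Rightarrow> 'a set set" where
  "quotient_ideal R J I = (\<lambda>a. I +>\<^bsub>R\<^esub> a) ` J"

text \<open>
  A simple undirected graph is represented as a loop-free symmetric digraph whose arcs are
  pairs of vertices. The vertex set may be infinite, so the finite locale \<open>graph\<close> does not
  apply; likewise \<open>complete_digraph\<close> is restricted to finite graphs.
\<close>

definition complete_graph :: "('a, 'b) pre_digraph \<Rightarrow> bool" where
  "complete_graph G \<longleftrightarrow> (\<forall>u \<in> verts G. \<forall>v \<in> verts G. u \<noteq> v \<longrightarrow> u \<rightarrow>\<^bsub>G\<^esub> v)"

text \<open>
  \<open>wf_digraph.\<mu>\<close> with unit weights is the number of arcs of a shortest walk, and is infinite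
  if there is none.
\<close>

definition distance :: "('a, 'b) pre_digraph \<Rightarrow> 'a \<Rightarrow> 'a \<Rightarrow> ereal" where
  "distance G u v = wf_digraph.\<mu> G (\<lambda>_. 1) u v"

definition diam :: "('a, 'b) pre_digraph \<Rightarrow> ereal" where
  "diam G = (SUP u \<in> verts G. SUP v \<in> verts G. distance G u v)"

definition proper_ideals :: "('a, 'b) ring_scheme \<Rightarrow> 'a set set" where
  "proper_ideals R = {I. ideal I R \<and> I \<noteq> carrier R}"

text \<open>
  \<open>\<Phi> K S\<close> is a property of an ideal \<open>K\<close> of a ring \<open>S\<close>, applied below to the ideal \<open>J/I\<close> of
  \<open>R Quot I\<close>.
\<close>

definition quotient_graph ::
  "('a set set \<Rightarrow> 'a set ring \<Rightarrow> bool) \<Rightarrow> ('a, 'b) ring_scheme \<Rightarrow> ('a set, 'a set \<times> 'a set) pre_digraph" where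
  "quotient_graph \<Phi> R = with_proj
     \<lparr> pverts = proper_ideals R,
       parcs = {(I, J). I \<in> proper_ideals R \<and> J \<in> proper_ideals R \<and>
                        (I \<subset> J \<and> \<Phi> (quotient_ideal R J I) (R Quot I) \<or>
                         J \<subset> I \<and> \<Phi> (quotient_ideal R I J) (R Quot J))} \<rparr>"

definition GF :: "('a, 'b) ring_scheme \<Rightarrow> ('a set, 'a set \<times> 'a set) pre_digraph" where
  "GF R = quotient_graph finitely_generated_ideal R"

definition GP :: "('a, 'b) ring_scheme \<Rightarrow> ('a set, 'a set \<times> 'a set) pre_digraph" where
  "GP R = quotient_graph principalideal R"

lemma loopfree_digraph_quotient_graph: "loopfree_digraph (quotient_graph \<Phi> R)"
  unfolding quotient_graph_def by unfold_locales auto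

lemma symmetric_quotient_graph: "symmetric (quotient_graph \<Phi> R)"
  unfolding quotient_graph_def symmetric_def by (auto intro!: symI)

end

theory Submission
  imports Defs
begin

text \<open>
  An edge \<open>I \<rightarrow> J\<close> with \<open>I \<subset> J\<close> says that \<open>J\<close> arises from \<open>I\<close> by adjoining finitely many
  elements (for the graph \<open>GF\<close>) or one element (for \<open>GP\<close>): \<open>J/I\<close> is generated by the classes of
  \<open>A\<close> if and only if \<open>J\<close> is generated by \<open>I \<union> A\<close>. After this translation
  (\<open>quotient_ideal_eq_genideal_iff\<close>) quotient rings no longer occur.

  By Zorn's lemma the maximal ideal \<open>M\<close> contains every proper ideal. If \<open>M\<close> is generated by
  \<open>n\<close> elements, then adjoining them to a proper ideal one at a time gives a walk of length at
  most \<open>n\<close> to \<open>M\<close> in \<open>GP\<close>, and adjoining them all at once gives a walk of length at most 1 in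
  \<open>GF\<close>. All vertices thus lie within a fixed radius of \<open>M\<close>, and the diameter is at most twice
  that radius.

  Conversely, the property that \<open>M\<close> is generated by \<open>I\<close> together with finitely many elements
  passes from a vertex \<open>I\<close> to every neighbour of \<open>I\<close> in \<open>GF\<close>, in either direction of the inclusion
  (\<open>finite_relative_generation_adj\<close>). It holds for \<open>I = M\<close>, so if the zero ideal is joined
  to \<open>M\<close>, then \<open>M\<close> is finitely generated. A walk in \<open>GP\<close> is in particular a walk in \<open>GF\<close>.

  Completeness means that any two proper ideals are comparable and the larger one arises from the
  smaller one by adjoining finitely many elements, respectively one. Comparing with the zero ideal
  shows that all ideals are then finitely generated, respectively principal. For a quasilocal
  ring, being Noetherian and chained is the same as being a principal ideal ring: finitely
  generated ideals of a chained ring are principal, and the converse rests on Nakayama's lemma.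
  That lemma also bounds the dimension: if prime ideals \<open>P = (p)\<close> and \<open>Q = (q)\<close> satisfy
  \<open>P \<subset> Q\<close>, then \<open>p = r q\<close> with \<open>r \<in> P\<close>, so \<open>p \<in> Q p\<close> and \<open>p = 0\<close>; hence there is no chain of
  three primes.
\<close>

section \<open>Ideals of a quotient ring\<close>

context ring
begin

lemma genideal_eq_self: "ideal I R \<Longrightarrow> Idl I = I"
  using genideal_minimal[of I I] genideal_self[of I] by (blast dest: ideal.Icarr)

lemma genideal_Un_genideal:
  assumes "A \<subseteq> carrier R" "B \<subseteq> carrier R"
  shows "Idl (Idl A \<union> B) = Idl (A \<union> B)"
proof
  have AB: "A \<union> B \<subseteq> carrier R" using assms by simp
  have "Idl A \<subseteq> Idl (A \<union> B)" using subset_Idl_subset[OF AB] by simp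
  moreover have "B \<subseteq> Idl (A \<union> B)" using genideal_self[OF AB] by simp
  ultimately show "Idl (Idl A \<union> B) \<subseteq> Idl (A \<union> B)"
    by (intro genideal_minimal genideal_ideal AB) simp
  have "Idl A \<union> B \<subseteq> carrier R"
    using assms genideal_ideal[OF assms(1)] by (auto dest: ideal.Icarr)
  moreover have "A \<union> B \<subseteq> Idl A \<union> B" using genideal_self[OF assms(1)] by auto
  ultimately show "Idl (A \<union> B) \<subseteq> Idl (Idl A \<union> B)"
    by (rule subset_Idl_subset)
qed

lemma genideal_Un_absorb:
  assumes A: "A \<subseteq> carrier R" and I: "I \<subseteq> Idl A"
  shows "Idl (I \<union> A) = Idl A"
proof
  note ideal = genideal_ideal[OF A]
  have "I \<subseteq> carrier R" using I ideal by (auto dest: ideal.Icarr)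
  then show "Idl A \<subseteq> Idl (I \<union> A)" using A by (intro subset_Idl_subset) auto
  show "Idl (I \<union> A) \<subseteq> Idl A" using I genideal_self[OF A] by (intro genideal_minimal ideal) simp
qed

lemma quotient_ideal_genideal:
  assumes I: "ideal I R" and B: "B \<subseteq> carrier R"
  shows "quotient_ideal R (Idl (I \<union> B)) I = Idl\<^bsub>R Quot I\<^esub> ((+>) I ` B)"
proof
  interpret Q: ring "R Quot I" using I by (rule ideal.quotient_is_ring)
  interpret pi: ring_hom_ring R "R Quot I" "(+>) I" using I by (rule ideal.rcos_ring_hom_ring)
  have IB: "I \<union> B \<subseteq> carrier R" using I B by (auto dest: ideal.Icarr)
  have piB: "(+>) I ` B \<subseteq> carrier (R Quot I)" using B by auto
  note gen = Q.genideal_ideal[OF piB]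
  \<comment> \<open>The preimage of the right-hand side is an ideal containing \<open>I\<close> and \<open>B\<close>.\<close>
  have "I \<subseteq> {r \<in> carrier R. I +> r \<in> Idl\<^bsub>R Quot I\<^esub> ((+>) I ` B)}"
  proof
    fix r assume r: "r \<in> I"
    have "\<zero>\<^bsub>R Quot I\<^esub> \<in> Idl\<^bsub>R Quot I\<^esub> ((+>) I ` B)"
      by (rule additive_subgroup.zero_closed[OF ideal.axioms(1)[OF gen]])
    moreover have "I +> r = \<zero>\<^bsub>R Quot I\<^esub>"
      unfolding a_rcos_zero[OF I r] by (simp only: FactRing_def ring.simps)
    ultimately have "I +> r \<in> Idl\<^bsub>R Quot I\<^esub> ((+>) I ` B)" by (simp only:)
    then show "r \<in> {r \<in> carrier R. I +> r \<in> Idl\<^bsub>R Quot I\<^esub> ((+>) I ` B)}"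
      using ideal.Icarr[OF I r] by blast
  qed
  moreover have "B \<subseteq> {r \<in> carrier R. I +> r \<in> Idl\<^bsub>R Quot I\<^esub> ((+>) I ` B)}"
    using B Q.genideal_self[OF piB] by auto
  ultimately have "Idl (I \<union> B) \<subseteq> {r \<in> carrier R. I +> r \<in> Idl\<^bsub>R Quot I\<^esub> ((+>) I ` B)}"
    by (intro genideal_minimal pi.ideal_vimage gen) simp
  then show "quotient_ideal R (Idl (I \<union> B)) I \<subseteq> Idl\<^bsub>R Quot I\<^esub> ((+>) I ` B)"
    by (auto simp: quotient_ideal_def)
  have "ideal (quotient_ideal R (Idl (I \<union> B)) I) (R Quot I)"
    unfolding quotient_ideal_def by (intro ring_ideal_imp_quot_ideal I genideal_ideal IB)
  moreover have "(+>) I ` B \<subseteq> quotient_ideal R (Idl (I \<union> B)) I"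
    using genideal_self[OF IB] by (auto simp: quotient_ideal_def)
  ultimately show "Idl\<^bsub>R Quot I\<^esub> ((+>) I ` B) \<subseteq> quotient_ideal R (Idl (I \<union> B)) I"
    by (rule Q.genideal_minimal)
qed

lemma quotient_ideal_mem_iff:
  assumes I: "ideal I R" and J: "ideal J R" "I \<subseteq> J" and a: "a \<in> carrier R"
  shows "I +> a \<in> quotient_ideal R J I \<longleftrightarrow> a \<in> J"
proof
  assume "I +> a \<in> quotient_ideal R J I"
  then obtain j where j: "j \<in> J" "I +> a = I +> j" by (auto simp: quotient_ideal_def)
  interpret J: ideal J R by fact
  have jc: "j \<in> carrier R" using j(1) by (rule J.Icarr)
  have "a \<ominus> j \<in> J" using quotient_eq_iff_same_a_r_cos[OF I a jc] j(2) J(2) by auto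
  then have "(a \<ominus> j) \<oplus> j \<in> J" using j(1) by (rule J.a_closed)
  moreover have "(a \<ominus> j) \<oplus> j = a" using a jc by (simp add: minus_eq a_assoc l_neg)
  ultimately show "a \<in> J" by simp
qed (auto simp: quotient_ideal_def)

lemma quotient_ideal_eq_iff:
  assumes "ideal I R" and J: "ideal J R" "I \<subseteq> J" and K: "ideal K R" "I \<subseteq> K"
  shows "quotient_ideal R J I = quotient_ideal R K I \<longleftrightarrow> J = K"
  using quotient_ideal_mem_iff[OF assms(1) J] quotient_ideal_mem_iff[OF assms(1) K]
    ideal.Icarr[OF J(1)] ideal.Icarr[OF K(1)] by blast

text \<open>
  The dictionary between edges and generators: ideals containing \<open>I\<close> are determined by their images modulo \<open>I\<close>, so generators of \<open>J/I\<close> are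
  the classes of elements that generate \<open>J\<close> together with \<open>I\<close>.
\<close>

lemma quotient_ideal_eq_genideal_iff:
  assumes I: "ideal I R" and J: "ideal J R" "I \<subseteq> J" and B: "B \<subseteq> carrier R"
  shows "quotient_ideal R J I = Idl\<^bsub>R Quot I\<^esub> ((+>) I ` B) \<longleftrightarrow> J = Idl (I \<union> B)"
proof -
  have IB: "I \<union> B \<subseteq> carrier R" using I B by (auto dest: ideal.Icarr)
  show ?thesis
    unfolding quotient_ideal_genideal[OF I B, symmetric]
    using genideal_self[OF IB] by (intro quotient_ideal_eq_iff I J genideal_ideal IB) simp
qed

lemma carrier_FactRing: "ideal I R \<Longrightarrow> carrier (R Quot I) = (+>) I ` carrier R"
  by (auto simp: FactRing_def A_RCOSETS_def')

lemma finitely_generated_quotient_ideal_iff: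
  assumes I: "ideal I R" and J: "ideal J R" "I \<subseteq> J"
  shows "finitely_generated_ideal (quotient_ideal R J I) (R Quot I) \<longleftrightarrow>
    (\<exists>A\<subseteq>carrier R. finite A \<and> J = Idl (I \<union> A))"
proof -
  have "ideal (quotient_ideal R J I) (R Quot I)"
    unfolding quotient_ideal_def by (intro ring_ideal_imp_quot_ideal I J)
  then have "finitely_generated_ideal (quotient_ideal R J I) (R Quot I) \<longleftrightarrow>
    (\<exists>A'. A' \<subseteq> (+>) I ` carrier R \<and> finite A' \<and> quotient_ideal R J I = Idl\<^bsub>R Quot I\<^esub> A')"
    by (simp add: finitely_generated_ideal_def carrier_FactRing[OF I])
  also have "\<dots> \<longleftrightarrow> (\<exists>A\<subseteq>carrier R. finite A \<and>
      quotient_ideal R J I = Idl\<^bsub>R Quot I\<^esub> ((+>) I ` A))"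
    using ex_finite_subset_image[of "(+>) I" "carrier R"
        "\<lambda>A'. quotient_ideal R J I = Idl\<^bsub>R Quot I\<^esub> A'"] by (simp only: conj_ac)
  also have "\<dots> \<longleftrightarrow> (\<exists>A\<subseteq>carrier R. finite A \<and> J = Idl (I \<union> A))"
    using quotient_ideal_eq_genideal_iff[OF I J] by blast
  finally show ?thesis .
qed

lemma principal_quotient_ideal_iff:
  assumes I: "ideal I R" and J: "ideal J R" "I \<subseteq> J"
  shows "principalideal (quotient_ideal R J I) (R Quot I) \<longleftrightarrow>
    (\<exists>a\<in>carrier R. J = Idl (insert a I))"
proof -
  have "ideal (quotient_ideal R J I) (R Quot I)"
    unfolding quotient_ideal_def by (intro ring_ideal_imp_quot_ideal I J)
  then have "principalideal (quotient_ideal R J I) (R Quot I) \<longleftrightarrow>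
    (\<exists>c\<in>(+>) I ` carrier R. quotient_ideal R J I = Idl\<^bsub>R Quot I\<^esub> {c})"
    by (simp add: principalideal_def principalideal_axioms_def carrier_FactRing[OF I])
  also have "\<dots> \<longleftrightarrow> (\<exists>a\<in>carrier R. J = Idl (insert a I))"
    using quotient_ideal_eq_genideal_iff[OF I J, of "{_}"] by simp
  finally show ?thesis .
qed

section \<open>Edges and walks in the two graphs\<close>

lemma GF_adj_iff:
  assumes "I \<in> proper_ideals R" "J \<in> proper_ideals R" "I \<subset> J"
  shows "I \<rightarrow>\<^bsub>GF R\<^esub> J \<longleftrightarrow> (\<exists>A\<subseteq>carrier R. finite A \<and> J = Idl (I \<union> A))"
  using assms finitely_generated_quotient_ideal_iff[of I J]
  by (auto simp: GF_def quotient_graph_def proper_ideals_def)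

lemma GP_adj_iff:
  assumes "I \<in> proper_ideals R" "J \<in> proper_ideals R" "I \<subset> J"
  shows "I \<rightarrow>\<^bsub>GP R\<^esub> J \<longleftrightarrow> (\<exists>a\<in>carrier R. J = Idl (insert a I))"
  using assms principal_quotient_ideal_iff[of I J]
  by (auto simp: GP_def quotient_graph_def proper_ideals_def)

end

lemma verts_GF: "verts (GF R) = proper_ideals R"
  and verts_GP: "verts (GP R) = proper_ideals R"
  by (simp_all add: GF_def GP_def quotient_graph_def)

lemma adj_quotient_graphD:
  assumes "I \<rightarrow>\<^bsub>quotient_graph \<Phi> R\<^esub> J"
  shows "I \<in> proper_ideals R" "J \<in> proper_ideals R" "I \<subset> J \<or> J \<subset> I"
  using assms by (auto simp: quotient_graph_def)

lemma wf_quotient_graph: "wf_digraph (quotient_graph \<Phi> R)"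
  using loopfree_digraph_quotient_graph by (rule loopfree_digraph.axioms(1))

lemma principalideal_imp_finitely_generated_ideal:
  "principalideal I R \<Longrightarrow> finitely_generated_ideal I R"
  unfolding finitely_generated_ideal_def principalideal_def principalideal_axioms_def
  by (metis empty_subsetI finite.simps insert_subset)

lemma GP_adj_imp_GF_adj: "I \<rightarrow>\<^bsub>GP R\<^esub> J \<Longrightarrow> I \<rightarrow>\<^bsub>GF R\<^esub> J"
  by (auto simp: GP_def GF_def quotient_graph_def
      intro: principalideal_imp_finitely_generated_ideal)

lemma connected_imp_rtrancl:
  assumes "wf_digraph G" "symmetric G" "Digraph_Component.connected G"
    and "u \<in> verts G" "v \<in> verts G"
  shows "(u, v) \<in> (arcs_ends G)\<^sup>*"
  using wf_digraph.symmetric_connected_imp_strongly_connected[OF assms(1-3)] assms(4,5)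
  by (auto simp: strongly_connected_def intro: reachable_rtranclI)

lemma sym_relpow: "sym r \<Longrightarrow> (u, v) \<in> r ^^ n \<Longrightarrow> (v, u) \<in> r ^^ n"
proof (induction n arbitrary: v)
  case (Suc n)
  from Suc.prems(2) obtain w where "(u, w) \<in> r ^^ n" "(w, v) \<in> r" by (rule relpow_Suc_E)
  then show ?case using Suc.IH Suc.prems(1) by (meson relpow_Suc_I2 symD)
qed simp

lemma (in wf_digraph) distance_le_relpow:
  assumes "(u, v) \<in> arcs_ends G ^^ n" "u \<in> verts G"
  shows "distance G u v \<le> ereal (real n)"
proof -
  have "\<exists>p. awalk u p v \<and> length p = n"
    using assms(1)
  proof (induction n arbitrary: v)
    case 0
    then show ?case using assms(2) by (simp add: awalk_Nil_iff)
  next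
    case (Suc n)
    then obtain w p e where p: "awalk u p w" "length p = n"
      and e: "e \<in> arcs G" "tail G e = w" "head G e = v"
      by (metis reachableE relpow_Suc_E)
    then have "awalk w [e] v" by (auto simp: awalk_Cons_iff awalk_Nil_iff)
    with p have "awalk u (p @ [e]) v" by (blast intro: awalk_appendI)
    then show ?case using p(2) by (intro exI[of _ "p @ [e]"]) simp
  qed
  then obtain p where p: "awalk u p v" "length p = n" by blast
  have "awalk_cost (\<lambda>_. 1) p = real n"
    unfolding awalk_cost_def p(2)[symmetric] by (simp add: sum_list_triv)
  then show ?thesis
    unfolding distance_def using min_cost_le_walk_cost[OF p(1), of "\<lambda>_. 1"] by simp
qed

text \<open>
  The diameter is at most twice the radius: any two vertices are joined by a walk through the
  centre.
\<close>

lemma connected_diam_of_radius: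
  assumes "wf_digraph G" and sym: "symmetric G" and c: "c \<in> verts G"
    and radius: "\<And>u. u \<in> verts G \<Longrightarrow> \<exists>k\<le>n. (u, c) \<in> arcs_ends G ^^ k"
  shows "Digraph_Component.connected G" "diam G \<le> ereal (real (2 * n))"
proof -
  interpret wf_digraph G by fact
  have walk: "\<exists>k\<le>2 * n. (u, v) \<in> arcs_ends G ^^ k" if u: "u \<in> verts G" and v: "v \<in> verts G" for u v
  proof -
    obtain k l where k: "k \<le> n" "(u, c) \<in> arcs_ends G ^^ k"
      and l: "l \<le> n" "(v, c) \<in> arcs_ends G ^^ l"
      using radius u v by blast
    have "(c, v) \<in> arcs_ends G ^^ l"
      using sym_relpow l(2) sym by (simp add: symmetric_def)
    with k(2) have "(u, v) \<in> arcs_ends G ^^ (k + l)" by (auto simp: relpow_add)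
    moreover have "k + l \<le> 2 * n" using k(1) l(1) by simp
    ultimately show ?thesis by blast
  qed
  have "distance G u v \<le> ereal (real (2 * n))" if u: "u \<in> verts G" and v: "v \<in> verts G" for u v
  proof -
    obtain k where "k \<le> 2 * n" "(u, v) \<in> arcs_ends G ^^ k" using walk u v by blast
    then show ?thesis using distance_le_relpow[OF _ u] by (fastforce intro: order_trans)
  qed
  then show "diam G \<le> ereal (real (2 * n))" by (auto simp: diam_def intro!: SUP_least)
  have "u \<rightarrow>\<^sup>*\<^bsub>G\<^esub> v" if u: "u \<in> verts G" and v: "v \<in> verts G" for u v
  proof -
    have "(u, v) \<in> (arcs_ends G)\<^sup>*" using walk[OF u v] by (auto dest: relpow_imp_rtrancl)
    then show ?thesis
      by (induction rule: rtrancl_induct) (auto simp: u intro: reachable_adj_trans)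
  qed
  then show "Digraph_Component.connected G"
    unfolding connected_def strongly_connected_def using c
    by (auto simp: reachable_mk_symmetric_eq[OF sym])
qed

section \<open>Quasilocal rings\<close>

context quasilocal_ring
begin

lemma M_proper: "M \<in> proper_ideals R"
  using I_notcarr by (simp add: proper_ideals_def is_ideal)

text \<open>
  The uniqueness of \<open>M\<close> concerns maximal ideals only; Krull's theorem, by Zorn's lemma, provides a
  maximal ideal above \<open>I\<close>.
\<close>

lemma proper_ideal_subset_M:
  assumes I: "I \<in> proper_ideals R"
  shows "I \<subseteq> M"
proof -
  \<comment> \<open>Properness in the form \<open>\<one> \<notin> J\<close> passes to unions of chains.\<close>
  define S where "S = {J. ideal J R \<and> I \<subseteq> J \<and> \<one> \<notin> J}"
  have IS: "I \<in> S" using I ideal.one_imp_carrier by (auto simp: S_def proper_ideals_def)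
  have "\<exists>N\<in>S. \<forall>J\<in>S. N \<subseteq> J \<longrightarrow> J = N"
  proof (rule subset_Zorn_nonempty)
    show "S \<noteq> {}" using IS by blast
    fix C assume C: "C \<noteq> {}" "subset.chain S C"
    then have "subset.chain {J. ideal J R} C" by (auto simp: pred_on.chain_def S_def)
    then have "ideal (\<Union>C) R" using chain_Union_is_ideal[of C] C(1) by simp
    then show "\<Union>C \<in> S" using C by (auto simp: pred_on.chain_def S_def)
  qed
  then obtain N where N: "N \<in> S" "\<And>J. J \<in> S \<Longrightarrow> N \<subseteq> J \<Longrightarrow> J = N" by blast
  have "maximalideal N R"
  proof (rule maximalidealI)
    show "ideal N R" "carrier R \<noteq> N" using N(1) by (auto simp: S_def)
    fix J assume J: "ideal J R" "N \<subseteq> J"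
    show "J = N \<or> J = carrier R"
    proof (cases "\<one> \<in> J")
      case True
      then show ?thesis using J(1) by (simp add: ideal.one_imp_carrier)
    next
      case False
      then have "J \<in> S" using J N(1) by (auto simp: S_def)
      then show ?thesis using N(2) J(2) by blast
    qed
  qed
  then show ?thesis using maximal_unique N(1) by (auto simp: S_def)
qed

lemma zero_proper: "{\<zero>} \<in> proper_ideals R"
proof -
  have "\<zero> \<in> M" by (rule additive_subgroup.zero_closed[OF is_additive_subgroup])
  then have "\<one> \<noteq> \<zero>" using I_notcarr one_imp_carrier by metis
  then have "{\<zero>} \<noteq> carrier R" using one_closed by (metis singletonD)
  then show ?thesis using zeroideal by (simp add: proper_ideals_def)
qed

lemma unit_if_notin_M:
  assumes a: "a \<in> carrier R" "a \<notin> M"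
  obtains b where "b \<in> carrier R" "b \<otimes> a = \<one>"
proof -
  have "PIdl a \<notin> proper_ideals R" using proper_ideal_subset_M cgenideal_self a by blast
  then have "PIdl a = carrier R" using cgenideal_ideal a(1) by (simp add: proper_ideals_def)
  then have "\<one> \<in> PIdl a" by simp
  then show ?thesis using that by (auto simp: cgenideal_def)
qed

text \<open>Nakayama's lemma for a cyclic module: \<open>1 - m\<close> is a unit that annihilates \<open>d\<close>.\<close>

lemma eq_zero_if_eq_mult_M:
  assumes m: "m \<in> M" and d: "d \<in> carrier R" "d = m \<otimes> d"
  shows "d = \<zero>"
proof -
  have mc: "m \<in> carrier R" using m by (rule Icarr)
  have "\<one> \<ominus> m \<notin> M"
  proof
    assume "\<one> \<ominus> m \<in> M"
    then have "(\<one> \<ominus> m) \<oplus> m \<in> M"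
      using m by (rule additive_subgroup.a_closed[OF is_additive_subgroup])
    moreover have "(\<one> \<ominus> m) \<oplus> m = \<one>" using mc by (simp add: minus_eq a_assoc l_neg)
    ultimately show False using one_imp_carrier I_notcarr by simp
  qed
  then obtain u where u: "u \<in> carrier R" "u \<otimes> (\<one> \<ominus> m) = \<one>"
    using unit_if_notin_M[of "\<one> \<ominus> m"] mc by blast
  have "(\<one> \<ominus> m) \<otimes> d = d \<ominus> m \<otimes> d" using mc d(1) by algebra
  also have "\<dots> = \<zero>" using d by (metis minus_eq r_neg)
  finally have "(u \<otimes> (\<one> \<ominus> m)) \<otimes> d = \<zero>" using u(1) mc d(1) by (simp add: m_assoc)
  then show ?thesis using u(2) d(1) by simp
qed

section \<open>Connectedness and diameter\<close>

text \<open>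
  If \<open>J\<close> arises from \<open>I\<close> by adjoining finitely many elements, these are added to the relative
  generators of \<open>M\<close>; if \<open>J \<subset> I\<close>, the old relative generators still work for the larger ideal.
\<close>

lemma finite_relative_generation_adj:
  assumes adj: "I \<rightarrow>\<^bsub>GF R\<^esub> J"
    and J: "\<exists>A\<subseteq>carrier R. finite A \<and> M = Idl (J \<union> A)"
  shows "\<exists>A\<subseteq>carrier R. finite A \<and> M = Idl (I \<union> A)"
proof -
  obtain A where A: "A \<subseteq> carrier R" "finite A" "M = Idl (J \<union> A)" using J by blast
  note IJ = adj_quotient_graphD[OF adj[unfolded GF_def]]
  have Ic: "I \<subseteq> carrier R" and Jc: "J \<subseteq> carrier R"
    using IJ(1,2) by (auto simp: proper_ideals_def dest: ideal.Icarr)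
  from IJ(3) show ?thesis
  proof
    assume "I \<subset> J"
    then obtain B where B: "B \<subseteq> carrier R" "finite B" "J = Idl (I \<union> B)"
      using adj GF_adj_iff IJ(1,2) by blast
    have "M = Idl (I \<union> (B \<union> A))"
      using A B Ic genideal_Un_genideal[of "I \<union> B" A] by (simp add: Un_assoc)
    then show ?thesis using A B by (intro exI[of _ "B \<union> A"]) simp
  next
    assume JI: "J \<subset> I"
    have JA: "J \<union> A \<subseteq> M" using A Jc genideal_self[of "J \<union> A"] by simp
    have "M \<subseteq> Idl (I \<union> A)"
      unfolding A(3) using JI A(1) Ic by (intro subset_Idl_subset) auto
    moreover have "Idl (I \<union> A) \<subseteq> M"
      using JA proper_ideal_subset_M[OF IJ(1)] by (intro genideal_minimal is_ideal) simp
    ultimately show ?thesis using A by blast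
  qed
qed

lemma finitely_generated_if_walk_from_zero:
  assumes "({\<zero>}, M) \<in> (arcs_ends (GF R))\<^sup>*"
  shows "finitely_generated_ideal M R"
proof -
  from assms have "\<exists>A\<subseteq>carrier R. finite A \<and> M = Idl ({\<zero>} \<union> A)"
  proof (induction rule: converse_rtrancl_induct)
    case base
    have "M = Idl (M \<union> {})" by (simp add: genideal_eq_self is_ideal)
    then show ?case by blast
  next
    case (step I J)
    then show ?case using finite_relative_generation_adj by blast
  qed
  then obtain A where "A \<subseteq> carrier R" "finite A" "M = Idl ({\<zero>} \<union> A)" by blast
  then show ?thesis
    unfolding finitely_generated_ideal_def using is_ideal by (intro conjI exI[of _ "{\<zero>} \<union> A"]) auto
qed

lemma connected_GF_imp_finitely_generated:
  assumes "Digraph_Component.connected (GF R)"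
  shows "finitely_generated_ideal M R"
proof (rule finitely_generated_if_walk_from_zero)
  show "({\<zero>}, M) \<in> (arcs_ends (GF R))\<^sup>*"
    using assms zero_proper M_proper wf_quotient_graph symmetric_quotient_graph
    by (intro connected_imp_rtrancl) (simp_all add: verts_GF, simp_all add: GF_def)
qed

lemma connected_GP_imp_finitely_generated:
  assumes "Digraph_Component.connected (GP R)"
  shows "finitely_generated_ideal M R"
proof (rule finitely_generated_if_walk_from_zero)
  have "({\<zero>}, M) \<in> (arcs_ends (GP R))\<^sup>*"
    using assms zero_proper M_proper wf_quotient_graph symmetric_quotient_graph
    by (intro connected_imp_rtrancl) (simp_all add: verts_GP, simp_all add: GP_def)
  moreover have "arcs_ends (GP R) \<subseteq> arcs_ends (GF R)" using GP_adj_imp_GF_adj by auto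
  ultimately show "({\<zero>}, M) \<in> (arcs_ends (GF R))\<^sup>*" using rtrancl_mono by blast
qed

lemma genideal_Un_generators_of_M:
  assumes "I \<in> proper_ideals R" "A \<subseteq> carrier R" "M = Idl A"
  shows "Idl (I \<union> A) = M"
  using genideal_Un_absorb[of A I] proper_ideal_subset_M assms by simp

lemma GF_radius:
  assumes M: "finitely_generated_ideal M R" and I: "I \<in> proper_ideals R"
  shows "\<exists>k\<le>1. (I, M) \<in> arcs_ends (GF R) ^^ k"
proof (cases "I = M")
  case True
  then show ?thesis by (intro exI[of _ 0]) simp
next
  case False
  then have "I \<subset> M" using proper_ideal_subset_M[OF I] by blast
  moreover obtain A where "A \<subseteq> carrier R" "finite A" "M = Idl A"
    using M by (auto simp: finitely_generated_ideal_def)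
  ultimately have "I \<rightarrow>\<^bsub>GF R\<^esub> M"
    using GF_adj_iff[OF I M_proper] genideal_Un_generators_of_M[OF I] by blast
  then show ?thesis by (intro exI[of _ 1]) simp
qed

text \<open>
  Adjoining the elements of \<open>B\<close> to \<open>I\<close> one at a time is a walk in \<open>GP\<close>; an element that is already
  present contributes no step, hence only an upper bound on the length. The hypothesis \<open>B \<subseteq> M\<close>
  keeps the intermediate ideals proper.
\<close>

lemma GP_walk_adjoining:
  assumes "finite B" and I: "I \<in> proper_ideals R" and "B \<subseteq> M"
  shows "\<exists>k\<le>card B. (I, Idl (I \<union> B)) \<in> arcs_ends (GP R) ^^ k"
  using assms(1,3)
proof (induction B rule: finite_induct)
  case empty
  have "Idl I = I" using I by (simp add: genideal_eq_self proper_ideals_def)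
  then show ?case by simp
next
  case (insert b B)
  have IM: "I \<subseteq> M" using I by (rule proper_ideal_subset_M)
  have proper: "Idl (I \<union> C) \<in> proper_ideals R" if "C \<subseteq> M" for C
  proof -
    have "Idl (I \<union> C) \<subseteq> M" using IM that by (intro genideal_minimal is_ideal) simp
    moreover have "ideal (Idl (I \<union> C)) R" using IM that a_subset by (intro genideal_ideal) blast
    ultimately show ?thesis using I_notcarr a_subset by (auto simp: proper_ideals_def)
  qed
  let ?J = "Idl (I \<union> B)" and ?K = "Idl (I \<union> insert b B)"
  have bc: "b \<in> carrier R" "I \<union> B \<subseteq> carrier R" using insert.prems IM a_subset by auto
  have K: "?K = Idl (insert b ?J)" using genideal_Un_genideal[of "I \<union> B" "{b}"] bc by simp
  obtain k where k: "k \<le> card B" "(I, ?J) \<in> arcs_ends (GP R) ^^ k"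
    using insert by auto
  show ?case
  proof (cases "?K = ?J")
    case True
    then show ?thesis using k insert.hyps by (metis card_insert_disjoint le_SucI)
  next
    case False
    moreover have "?J \<subseteq> ?K" using bc by (intro subset_Idl_subset) auto
    ultimately have "?J \<subset> ?K" by blast
    then have "?J \<rightarrow>\<^bsub>GP R\<^esub> ?K"
      using GP_adj_iff[OF proper proper, of B "insert b B"] insert.prems K bc(1) by auto
    with k(2) have "(I, ?K) \<in> arcs_ends (GP R) ^^ Suc k" by (rule relpow_Suc_I)
    then show ?thesis using k(1) insert.hyps by (intro exI[of _ "Suc k"]) simp
  qed
qed

lemma GP_radius:
  assumes M: "finitely_generated_ideal M R" and I: "I \<in> proper_ideals R"
  shows "\<exists>k\<le>min_generators R M. (I, M) \<in> arcs_ends (GP R) ^^ k"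
proof -
  have "\<exists>n. \<exists>A\<subseteq>carrier R. finite A \<and> card A = n \<and> M = Idl A"
    using M by (auto simp: finitely_generated_ideal_def)
  from LeastI_ex[OF this] obtain A where A: "A \<subseteq> carrier R" "finite A"
    "card A = min_generators R M" "M = Idl A"
    unfolding min_generators_def by blast
  then have "A \<subseteq> M" using genideal_self by simp
  from GP_walk_adjoining[OF A(2) I this] show ?thesis
    by (simp add: A(3) genideal_Un_generators_of_M[OF I A(1,4)])
qed

section \<open>Principal ideal rings, chained rings and completeness\<close>

text \<open>
  Let \<open>(a, b) = (d)\<close>, \<open>a = a' d\<close> and \<open>b = b' d\<close>. If \<open>a'\<close> is a unit then \<open>b \<in> (d) = (a)\<close>, and
  symmetrically for \<open>b'\<close>. Otherwise \<open>d = x a + y b \<in> M d\<close>, so \<open>d = 0\<close>.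
\<close>

lemma principal_imp_elements_comparable:
  assumes pir: "principal_ideal_ring R" and a: "a \<in> carrier R" and b: "b \<in> carrier R"
  shows "a \<in> PIdl b \<or> b \<in> PIdl a"
proof -
  have ideal: "ideal (PIdl a <+> PIdl b) R"
    using a b by (intro add_ideals cgenideal_ideal)
  then have "principalideal (PIdl a <+> PIdl b) R"
    using pir by (simp add: principal_ideal_ring.all_principal)
  then obtain d where d: "d \<in> carrier R" "PIdl a <+> PIdl b = PIdl d"
    by (auto simp: principalideal_def principalideal_axioms_def cgenideal_eq_genideal)
  have "PIdl a \<union> PIdl b \<subseteq> Idl (PIdl a \<union> PIdl b)"
    using a b by (intro genideal_self) (auto simp: cgenideal_def)
  then have "PIdl a \<union> PIdl b \<subseteq> PIdl d"
    using a b d(2) by (simp add: union_genideal cgenideal_ideal)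
  then have "a \<in> PIdl d" "b \<in> PIdl d" using cgenideal_self a b by auto
  then obtain a' b' where a': "a' \<in> carrier R" "a = a' \<otimes> d" and b': "b' \<in> carrier R" "b = b' \<otimes> d"
    by (auto simp: cgenideal_def)
  have unit_case: "v \<otimes> d \<in> PIdl (u \<otimes> d)" if u: "u \<in> carrier R" "u \<notin> M" and v: "v \<in> carrier R" for u v
  proof -
    obtain w where w: "w \<in> carrier R" "w \<otimes> u = \<one>" using unit_if_notin_M[OF u] by blast
    have "v \<otimes> d = v \<otimes> ((w \<otimes> u) \<otimes> d)" using w(2) d(1) by simp
    also have "\<dots> = (v \<otimes> w) \<otimes> (u \<otimes> d)" using u(1) v w(1) d(1) by (simp add: m_assoc)
    finally show ?thesis using v w(1) by (auto simp: cgenideal_def)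
  qed
  show ?thesis
  proof (cases "a' \<in> M \<and> b' \<in> M")
    case True
    have "d \<in> PIdl a <+> PIdl b" using d cgenideal_self by simp
    then obtain x y where xy: "x \<in> carrier R" "y \<in> carrier R" "d = x \<otimes> a \<oplus> y \<otimes> b"
      by (auto simp: set_add_def' cgenideal_def)
    have "d = (x \<otimes> a' \<oplus> y \<otimes> b') \<otimes> d"
      using xy a' b' d(1) by (metis l_distr m_assoc m_closed)
    moreover have "x \<otimes> a' \<oplus> y \<otimes> b' \<in> M" using True xy by (simp add: I_l_closed)
    ultimately have "d = \<zero>" using eq_zero_if_eq_mult_M d(1) by blast
    then show ?thesis using a' b' cgenideal_self[OF a] by simp
  next
    case False
    then show ?thesis using unit_case a' b' by blast
  qed
qed

lemma principal_imp_chained: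
  assumes "principal_ideal_ring R"
  shows "chained_ring R"
proof unfold_locales
  fix I J assume I: "ideal I R" and J: "ideal J R"
  show "I \<subseteq> J \<or> J \<subseteq> I"
  proof (rule ccontr)
    assume "\<not> (I \<subseteq> J \<or> J \<subseteq> I)"
    then obtain a b where ab: "a \<in> I" "a \<notin> J" "b \<in> J" "b \<notin> I" by blast
    then have "a \<in> PIdl b \<or> b \<in> PIdl a"
      using principal_imp_elements_comparable[OF assms] I J by (simp add: ideal.Icarr)
    then show False using ab cgenideal_minimal I J by blast
  qed
qed

text \<open>Of two generators, the one with the larger principal ideal makes the other redundant.\<close>

lemma chained_imp_finitely_generated_principal:
  assumes chained: "chained_ring R" and "finite A" "A \<subseteq> carrier R"
  shows "\<exists>c\<in>carrier R. Idl A = Idl {c}"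
  using assms(2,3)
proof (induction A rule: finite_induct)
  case empty
  have "Idl {} = Idl {\<zero>}"
    using genideal_minimal[OF zeroideal] genideal_zero
      additive_subgroup.zero_closed[OF ideal.axioms(1)[OF genideal_ideal[of "{}"]]] by auto
  then show ?case by blast
next
  case (insert a A)
  then obtain c where c: "c \<in> carrier R" "Idl A = Idl {c}" by auto
  have a: "a \<in> carrier R" and A: "A \<subseteq> carrier R" using insert.prems by auto
  have ideals: "ideal (Idl {a}) R" "ideal (Idl {c}) R" using a c by (auto intro: genideal_ideal)
  have "Idl {c} \<subseteq> carrier R" using ideals(2) by (auto dest: ideal.Icarr)
  then have eq: "Idl (insert a A) = Idl (Idl {c} \<union> Idl {a})"
    using genideal_Un_genideal[of A "{a}"] genideal_Un_genideal[of "{a}" "Idl {c}"] a A c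
    by (simp add: Un_commute)
  from ideals have "Idl {a} \<subseteq> Idl {c} \<or> Idl {c} \<subseteq> Idl {a}"
    using chained_ring.ideals_total[OF chained] by blast
  then show ?case using eq ideals a c(1) by (metis genideal_eq_self sup.absorb1 sup.absorb2)
qed

lemma noetherian_chained_iff_principal:
  "noetherian_ring R \<and> chained_ring R \<longleftrightarrow> principal_ideal_ring R"
proof
  assume nc: "noetherian_ring R \<and> chained_ring R"
  show "principal_ideal_ring R"
  proof (intro principal_ideal_ring.intro principal_ideal_ring_axioms.intro is_cring)
    fix I assume I: "ideal I R"
    then obtain A where "A \<subseteq> carrier R" "finite A" "I = Idl A"
      using nc noetherian_ring.finetely_gen by blast
    then show "principalideal I R"
      using nc chained_imp_finitely_generated_principal I by (auto intro!: principalidealI)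
  qed
next
  assume pir: "principal_ideal_ring R"
  have "noetherian_ring R"
  proof (rule noetherian_ringI)
    fix I assume "ideal I R"
    then have "finitely_generated_ideal I R"
      using pir principal_ideal_ring.all_principal principalideal_imp_finitely_generated_ideal
      by blast
    then show "\<exists>A\<subseteq>carrier R. finite A \<and> I = Idl A" by (simp add: finitely_generated_ideal_def)
  qed
  then show "noetherian_ring R \<and> chained_ring R" using principal_imp_chained pir by blast
qed

text \<open>
  Write \<open>P = (p)\<close>, \<open>Q = (q)\<close> and \<open>p = r q\<close>. Since \<open>q \<notin> P\<close>, primality gives \<open>r = s p\<close>. Hence
  \<open>p = (s q) p\<close> with \<open>s q \<in> M\<close>, and \<open>p = 0\<close>.
\<close>

lemma principal_nonmaximal_prime_eq_zero:
  assumes pir: "principal_ideal_ring R"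
    and P: "primeideal P R" and Q: "primeideal Q R" and PQ: "P \<subset> Q"
  shows "P = {\<zero>}"
proof -
  interpret P: primeideal P R by fact
  interpret Q: primeideal Q R by fact
  obtain p where p: "p \<in> carrier R" "P = PIdl p"
    using principal_ideal_ring.all_principal[OF pir P.is_ideal]
    by (auto simp: principalideal_def principalideal_axioms_def cgenideal_eq_genideal)
  obtain q where q: "q \<in> carrier R" "Q = PIdl q"
    using principal_ideal_ring.all_principal[OF pir Q.is_ideal]
    by (auto simp: principalideal_def principalideal_axioms_def cgenideal_eq_genideal)
  have "p \<in> PIdl q" using cgenideal_self p q PQ by blast
  then obtain r where r: "r \<in> carrier R" "p = r \<otimes> q" by (auto simp: cgenideal_def)
  have "q \<notin> P" using PQ q cgenideal_minimal[OF P.is_ideal] by blast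
  moreover have "r \<otimes> q \<in> P"
    unfolding r(2)[symmetric] p(2) using p(1) by (rule cgenideal_self)
  ultimately have "r \<in> PIdl p" using P.I_prime[OF r(1) q(1)] unfolding p(2) by blast
  then obtain s where s: "s \<in> carrier R" "r = s \<otimes> p"
    unfolding cgenideal_def by blast
  have "p = (s \<otimes> p) \<otimes> q" unfolding s(2)[symmetric] by (rule r(2))
  also have "\<dots> = (s \<otimes> q) \<otimes> p" using s(1) p(1) q(1) by (simp add: m_ac)
  finally have "p = (s \<otimes> q) \<otimes> p" .
  moreover have "Q \<subseteq> M"
    using Q.I_notcarr Q.is_ideal by (intro proper_ideal_subset_M) (simp add: proper_ideals_def)
  then have "s \<otimes> q \<in> M" using q(2) cgenideal_self[OF q(1)] s(1) by (auto intro: I_l_closed)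
  ultimately have "p = \<zero>" using eq_zero_if_eq_mult_M p(1) by blast
  then show ?thesis using p(2) genideal_zero by (simp add: cgenideal_eq_genideal)
qed

lemma principal_imp_krull_dim_le_1:
  assumes pir: "principal_ideal_ring R"
  shows "krull_dim R \<le> 1"
  unfolding krull_dim_def
proof (rule SUP_least, clarify)
  fix n and P :: "nat \<Rightarrow> 'a set"
  assume prime: "\<forall>i\<le>n. primeideal (P i) R" and strict: "\<forall>i<n. P i \<subset> P (Suc i)"
  have "n \<le> 1"
  proof (rule ccontr)
    assume "\<not> n \<le> 1"
    then have "P 0 = {\<zero>}" "P 1 = {\<zero>}"
      using principal_nonmaximal_prime_eq_zero[OF pir, of "P 0" "P 1"]
        principal_nonmaximal_prime_eq_zero[OF pir, of "P 1" "P 2"] prime strict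
      by (auto simp: numeral_2_eq_2)
    moreover have "P 0 \<subset> P 1" using strict \<open>\<not> n \<le> 1\<close> by auto
    ultimately show False by simp
  qed
  then show "enat n \<le> 1" by (simp add: one_enat_def)
qed

lemma complete_GF_iff: "complete_graph (GF R) \<longleftrightarrow> noetherian_ring R \<and> chained_ring R"
proof
  assume complete: "complete_graph (GF R)"
  have adj: "I \<rightarrow>\<^bsub>GF R\<^esub> J" if "I \<in> proper_ideals R" "J \<in> proper_ideals R" "I \<noteq> J" for I J
    using complete that by (simp add: complete_graph_def verts_GF)
  have "noetherian_ring R"
  proof (rule noetherian_ringI)
    fix J assume J: "ideal J R"
    show "\<exists>A\<subseteq>carrier R. finite A \<and> J = Idl A"
    proof (cases "J = carrier R \<or> J = {\<zero>}")
      case True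
      then show ?thesis
        using genideal_one genideal_zero
        by (metis empty_subsetI finite.simps insert_subset one_closed zero_closed)
    next
      case False
      then have Jp: "J \<in> proper_ideals R" using J by (simp add: proper_ideals_def)
      have "{\<zero>} \<subset> J"
        using False J additive_subgroup.zero_closed ideal.axioms(1) by blast
      then obtain A where "A \<subseteq> carrier R" "finite A" "J = Idl ({\<zero>} \<union> A)"
        using adj[OF zero_proper Jp] GF_adj_iff[OF zero_proper Jp] by blast
      then show ?thesis by (intro exI[of _ "{\<zero>} \<union> A"]) simp
    qed
  qed
  moreover have "chained_ring R"
  proof unfold_locales
    fix I J assume I: "ideal I R" and J: "ideal J R"
    show "I \<subseteq> J \<or> J \<subseteq> I"
    proof (cases "I = carrier R \<or> J = carrier R \<or> I = J")
      case True
      then show ?thesis using I J by (auto dest: ideal.Icarr)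
    next
      case False
      then have "I \<rightarrow>\<^bsub>GF R\<^esub> J" using adj I J by (simp add: proper_ideals_def)
      then show ?thesis using adj_quotient_graphD(3) unfolding GF_def by blast
    qed
  qed
  ultimately show "noetherian_ring R \<and> chained_ring R" by simp
next
  assume nc: "noetherian_ring R \<and> chained_ring R"
  have up: "I \<rightarrow>\<^bsub>GF R\<^esub> J" if I: "I \<in> proper_ideals R" and J: "J \<in> proper_ideals R" and IJ: "I \<subset> J" for I J
  proof -
    have Ji: "ideal J R" using J by (simp add: proper_ideals_def)
    obtain A where A: "A \<subseteq> carrier R" "finite A" "J = Idl A"
      using nc Ji noetherian_ring.finetely_gen by blast
    have "Idl (I \<union> A) = J"
      using genideal_Un_absorb[of A I] IJ A by simp
    then show ?thesis using GF_adj_iff[OF I J IJ] A by blast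
  qed
  show "complete_graph (GF R)"
    unfolding complete_graph_def verts_GF
  proof (intro ballI impI)
    fix I J assume I: "I \<in> proper_ideals R" and J: "J \<in> proper_ideals R" and "I \<noteq> J"
    then have "I \<subset> J \<or> J \<subset> I"
      using nc chained_ring.ideals_total[of R I J] by (auto simp: proper_ideals_def)
    then show "I \<rightarrow>\<^bsub>GF R\<^esub> J"
      using up I J arcs_ends_symmetric[OF symmetric_quotient_graph] unfolding GF_def by blast
  qed
qed

lemma complete_GP_iff: "complete_graph (GP R) \<longleftrightarrow> principal_ideal_ring R"
proof
  assume complete: "complete_graph (GP R)"
  show "principal_ideal_ring R"
  proof (intro principal_ideal_ring.intro principal_ideal_ring_axioms.intro is_cring)
    fix J assume J: "ideal J R"
    have "\<exists>a\<in>carrier R. J = Idl {a}"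
    proof (cases "J = carrier R \<or> J = {\<zero>}")
      case True
      then show ?thesis using genideal_one genideal_zero by (metis one_closed zero_closed)
    next
      case False
      then have Jp: "J \<in> proper_ideals R" using J by (simp add: proper_ideals_def)
      have 0: "{\<zero>} \<subset> J"
        using False J additive_subgroup.zero_closed ideal.axioms(1) by blast
      then have "{\<zero>} \<rightarrow>\<^bsub>GP R\<^esub> J"
        using complete zero_proper Jp by (auto simp: complete_graph_def verts_GP)
      then obtain a where a: "a \<in> carrier R" "J = Idl {a, \<zero>}"
        using GP_adj_iff[OF zero_proper Jp 0] by blast
      have "\<zero> \<in> Idl {a}"
        using genideal_ideal[of "{a}"] a(1)
        by (simp add: additive_subgroup.zero_closed ideal.axioms(1))
      then have "Idl {a, \<zero>} = Idl {a}"
        using genideal_Un_absorb[of "{a}" "{\<zero>}"] a(1) by (simp add: insert_commute)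
      then show ?thesis using a by blast
    qed
    then show "principalideal J R" using J by (intro principalidealI)
  qed
next
  assume pir: "principal_ideal_ring R"
  have up: "I \<rightarrow>\<^bsub>GP R\<^esub> J" if I: "I \<in> proper_ideals R" and J: "J \<in> proper_ideals R" and IJ: "I \<subset> J" for I J
  proof -
    have Ji: "ideal J R" using J by (simp add: proper_ideals_def)
    obtain a where a: "a \<in> carrier R" "J = Idl {a}"
      using principal_ideal_ring.all_principal[OF pir Ji]
      by (auto simp: principalideal_def principalideal_axioms_def)
    have "Idl (insert a I) = J"
      using genideal_Un_absorb[of "{a}" I] IJ a by simp
    then show ?thesis using GP_adj_iff[OF I J IJ] a(1) by blast
  qed
  show "complete_graph (GP R)"
    unfolding complete_graph_def verts_GP
  proof (intro ballI impI)
    fix I J assume I: "I \<in> proper_ideals R" and J: "J \<in> proper_ideals R" and "I \<noteq> J"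
    then have "I \<subset> J \<or> J \<subset> I"
      using chained_ring.ideals_total[OF principal_imp_chained[OF pir], of I J]
      by (auto simp: proper_ideals_def)
    then show "I \<rightarrow>\<^bsub>GP R\<^esub> J"
      using up I J arcs_ends_symmetric[OF symmetric_quotient_graph] unfolding GP_def by blast
  qed
qed

end

section \<open>The graphs of a quasilocal ring\<close>

theorem theorem6p3:
  fixes R :: "('a, 'b) ring_scheme" and M :: "'a set"
  assumes "quasilocal_ring M R"
  shows "(Digraph_Component.connected (GF R) \<longleftrightarrow> finitely_generated_ideal M R)
    \<and> (Digraph_Component.connected (GP R) \<longleftrightarrow> finitely_generated_ideal M R)
    \<and> (Digraph_Component.connected (GF R) \<longrightarrow> diam (GF R) \<le> 2)
    \<and> (complete_graph (GF R) \<longleftrightarrow> noetherian_ring R \<and> chained_ring R \<and> krull_dim R \<le> 1)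
    \<and> (Digraph_Component.connected (GP R) \<longrightarrow> diam (GP R) \<le> ereal (real (2 * min_generators R M)))
    \<and> (complete_graph (GP R) \<longleftrightarrow> principal_ideal_ring R)"
proof -
  interpret quasilocal_ring M R by fact
  have graphs: "wf_digraph (GF R)" "symmetric (GF R)" "wf_digraph (GP R)" "symmetric (GP R)"
    unfolding GF_def GP_def by (fact wf_quotient_graph symmetric_quotient_graph)+
  have M: "M \<in> verts (GF R)" "M \<in> verts (GP R)" by (simp_all add: verts_GF verts_GP M_proper)
  have F: "Digraph_Component.connected (GF R)" "diam (GF R) \<le> 2"
    if "finitely_generated_ideal M R"
    using connected_diam_of_radius[OF graphs(1,2) M(1), of 1] GF_radius[OF that]
    by (simp_all add: verts_GF)
  have P: "Digraph_Component.connected (GP R)"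
    "diam (GP R) \<le> ereal (real (2 * min_generators R M))"
    if "finitely_generated_ideal M R"
    using connected_diam_of_radius[OF graphs(3,4) M(2), of "min_generators R M"] GP_radius[OF that]
    by (simp_all add: verts_GP)
  show ?thesis
    using F P connected_GF_imp_finitely_generated connected_GP_imp_finitely_generated
      complete_GF_iff complete_GP_iff noetherian_chained_iff_principal principal_imp_krull_dim_le_1
    by blast
qed

end
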